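(* Consider the system $x_{t+1}=f(x_t)+Bu_t$ with $f(x)=AZ(x)$, the data matrices $U_0,Z_0,X_1$ satisfying $X_1=AZ_0+BU_0$, and functions $L$, $\alpha_1,\dots,\alpha_N$ and a set $\mathcal X\subseteq\mathbb R^n$ satisfying properties (i)–(iii), all as described in the context. Let $K_i\in\mathbb R^{m\times S}$, $G_i\in\mathbb R^{T\times S}$, $i\in\{1,\dots,N\}$, satisfy $$\begin{bmatrix}U_0\\ Z_0\end{bmatrix}G_i=\begin{bmatrix}K_i\\ I_S\end{bmatrix},\qquad i=1,\dots,N,$$ and let $G(x)=\sum_{i=1}^N\alpha_i(x)G_i=\begin{bmatrix}\overline G(x)&\underline G(x)\end{bmatrix}$ with $\overline G(x)\in\mathbb R^{T\times n}$, $\underline G(x)\in\mathbb R^{T\times (S-n)}$. Consider the polytopic linear parameter-varying descriptor system $$\begin{bmatrix}I_n&0\\ 0&0\end{bmatrix}\eta_{t+1}=\begin{bmatrix}X_1G(\rho_t)\\ L(\rho_t)\end{bmatrix}\eta_t,\qquad \eta_t\in\mathbb R^S,$$ for which $\rho_t\in\mathcal X\subseteq\mathbb R^n$ for all $t\in\mathbb N$. If this descriptor system is poly-quadratically admissible, then the origin of the nonlinear closed-loop system $$x_{t+1}=X_1G(x_t)Z(x_t)=\left(X_1\overline G(x_t)-X_1\underline G(x_t)L_2^{-1}(x_t)L_1(x_t)\right)x_t$$ (the second equality holding for $x_t\in\mathcal X$) is locally asymptotically stable. Furthermore, if $\mathcal X=\mathbb R^n$, then the origin is globally asymptotically stable.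
   Context: System and basis functions: $x_t\in\mathbb R^n$, $u_t\in\mathbb R^m$, $B\in\mathbb R^{n\times m}$. The function $f:\mathbb R^n\to\mathbb R^n$ is continuous, $f(0)=0$, and $f(x)=AZ(x)$ with $A\in\mathbb R^{n\times S}$ and $Z:\mathbb R^n\to\mathbb R^S$ continuous, $Z(0)=0$, of the form $Z(x)=\begin{bmatrix}x^\top&\underline Z(x)^\top\end{bmatrix}^\top$ with $\underline Z:\mathbb R^n\to\mathbb R^{S-n}$. Data: input-state data $\{u^d_k,x^d_k\}_{k=0}^T$ with $x^d_{k+1}=AZ(x^d_k)+Bu^d_k$ are arranged as $U_0=[u^d_0\ \cdots\ u^d_{T-1}]\in\mathbb R^{m\times T}$, $Z_0=[Z(x^d_0)\ \cdots\ Z(x^d_{T-1})]\in\mathbb R^{S\times T}$, $X_1=[x^d_1\ \cdots\ x^d_T]\in\mathbb R^{n\times T}$, so $X_1=AZ_0+BU_0$. Assumption on $L$: there is a function $L:\mathbb R^n\to\mathbb R^{(S-n)\times S}$ such that for all $x\in\mathcal X\subseteq\mathbb R^n$, where $0\in\mathrm{int}(\mathcal X)$: (i) $L(x)Z(x)=0$; (ii) $L(x)=\begin{bmatrix}L_1(x)&L_2(x)\end{bmatrix}$ with $L_2(x)\in\mathbb R^{(S-n)\times(S-n)}$ invertible; (iii) $L(x)=\sum_{i=1}^N\alpha_i(x)\mathcal L_i$ with $\mathcal L_i=L(v_i)$ for some $v_i\in\mathcal X$, where the $\alpha_i$ are continuous functions of $x\in\mathbb R^n$ satisfying $\alpha_i(x)\ge0$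 and $\sum_{i=1}^N\alpha_i(x)=1$ (for $x\in\mathcal X$). Poly-quadratic admissibility: a system $E\eta_{t+1}=A(\rho_t)\eta_t$ with $E$ singular, $\rho_t\in\mathcal D$, $A(\rho)=\sum_i\alpha_i(\rho)A_i$, is poly-quadratically admissible if it is regular (existence and uniqueness of solutions) and causal over the polytope of matrices $A(\rho)$, and there is a parameter-dependent Lyapunov function $V(\eta)=\eta^\top E^\top P(\rho)E\eta$, $P(\rho)=\sum_i\alpha_i(\rho)P_i$, $P_i\succ0$, with $V(\eta_{t+1})-V(\eta_t)<0$ for all $\eta\ne0$. For $E=\begin{bmatrix}I_r&0\\ 0&0\end{bmatrix}$ and $A(\rho)=\begin{bmatrix}A_{11}(\rho)&A_{12}(\rho)\\ A_{21}(\rho)&A_{22}(\rho)\end{bmatrix}$ partitioned conformally, it is a known result (used by the paper as the characterization) that the system is poly-quadratically admissible if and only if $A_{22}(\rho)$ is invertible for all $\rho\in\mathcal D$ and, with $\bar A(\rho)=A_{11}(\rho)-A_{12}(\rho)A_{22}^{-1}(\rho)A_{21}(\rho)$, the system $\bar\eta_{1,t+1}=\bar A(\rho_t)\bar\eta_{1,t}$ is poly-quadratically stable, i.e. there exist $\bar P_i\succ0$ in $\mathbb R^{r\times r}$ such that $\bar P(\rho)=\sum_i\alpha_i(\rho)\bar P_i$ satisfies $\bar A(\rho_t)^\top\bar P(\rho_{t+1})\bar A(\rho_t)-\bar P(\rho_t)\prec0$ for all $\rho_t,\rho_{t+1}\in\mathcal D$. In the claim, $\mathcal D=\mathcal X$,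 $r=n$ and $A_i=\begin{bmatrix}X_1G_i\\ \mathcal L_i\end{bmatrix}$. $\succ0$ ($\prec0$) denotes symmetric positive (negative) definite. *)

theory Defs
  imports "HOL-Analysis.Analysis" "HOL-Computational_Algebra.Polynomial"
begin

(* A space of dimension S = n + (S - n) is real ^ ('n + 'p) with CARD('p) = S - n.  Since vcat is
   polymorphic in the entries, it stacks vectors and, entries being rows, also matrices. *)
definition vcat :: "'a ^ 'n \<Rightarrow> 'a ^ 'p \<Rightarrow> 'a ^ ('n + 'p)" where
  "vcat a b = (\<chi> i. case i of Inl k \<Rightarrow> a $ k | Inr k \<Rightarrow> b $ k)"

definition hcat :: "'a ^ 'n ^ 'm \<Rightarrow> 'a ^ 'p ^ 'm \<Rightarrow> 'a ^ ('n + 'p) ^ 'm" where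
  "hcat M N = (\<chi> i. vcat (M $ i) (N $ i))"

(* Columns are the samples s 0, ..., s (T - 1); tau is an enumeration of the column index type
   by these times. *)
definition data_matrix :: "('t \<Rightarrow> nat) \<Rightarrow> (nat \<Rightarrow> real ^ 'n) \<Rightarrow> real ^ 't ^ 'n" where
  "data_matrix \<tau> s = (\<chi> i j. s (\<tau> j) $ i)"

definition polytopic :: "nat \<Rightarrow> (nat \<Rightarrow> 'q \<Rightarrow> real) \<Rightarrow> (nat \<Rightarrow> real ^ 'k ^ 'm) \<Rightarrow> 'q \<Rightarrow> real ^ 'k ^ 'm" where
  "polytopic N \<alpha> M \<rho> = (\<Sum>i = 1..N. \<alpha> i \<rho> *\<^sub>R M i)"

definition pos_def :: "real ^ 'n ^ 'n \<Rightarrow> bool" where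
  "pos_def P \<longleftrightarrow> transpose P = P \<and> (\<forall>v. v \<noteq> 0 \<longrightarrow> 0 < v \<bullet> (P *v v))"


(* The pencil z E - A as a matrix over the polynomials in z. *)
definition pencil :: "real ^ 's ^ 's \<Rightarrow> real ^ 's ^ 's \<Rightarrow> real poly ^ 's ^ 's" where
  "pencil E A = (\<chi> i j. monom (E $ i $ j) 1 - [:A $ i $ j:])"

(* Regularity of the pencil is the standard meaning of existence and uniqueness of solutions
   of E eta(t+1) = A eta(t). *)
definition regular_pair :: "real ^ 's ^ 's \<Rightarrow> real ^ 's ^ 's \<Rightarrow> bool" where
  "regular_pair E A \<longleftrightarrow> det (pencil E A) \<noteq> 0"

definition causal_pair :: "real ^ 's ^ 's \<Rightarrow> real ^ 's ^ 's \<Rightarrow> bool" where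
  "causal_pair E A \<longleftrightarrow> degree (det (pencil E A)) = rank E"

definition descriptor_solution ::
  "real ^ 's ^ 's \<Rightarrow> ('q \<Rightarrow> real ^ 's ^ 's) \<Rightarrow> 'q set \<Rightarrow> (nat \<Rightarrow> 'q) \<Rightarrow> (nat \<Rightarrow> real ^ 's) \<Rightarrow> bool" where
  "descriptor_solution E A D \<rho> \<eta> \<longleftrightarrow>
     (\<forall>t. \<rho> t \<in> D) \<and> (\<forall>t. E *v \<eta> (Suc t) = A (\<rho> t) *v \<eta> t)"

definition descriptor_lyapunov ::
  "real ^ 's ^ 's \<Rightarrow> ('q \<Rightarrow> real ^ 's ^ 's) \<Rightarrow> 'q \<Rightarrow> real ^ 's \<Rightarrow> real" where
  "descriptor_lyapunov E P \<rho> \<eta> = \<eta> \<bullet> ((transpose E ** P \<rho> ** E) *v \<eta>)"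

(* The system is E eta(t+1) = (SUM i = 1..N. alpha i (rho t) * Av i) eta(t) with rho t in D.  The
   Lyapunov function at time t is evaluated at the current parameter rho t. *)
definition poly_quadratically_admissible ::
  "real ^ 's ^ 's \<Rightarrow> nat \<Rightarrow> (nat \<Rightarrow> 'q \<Rightarrow> real) \<Rightarrow> (nat \<Rightarrow> real ^ 's ^ 's) \<Rightarrow> 'q set \<Rightarrow> bool" where
  "poly_quadratically_admissible E N \<alpha> Av D \<longleftrightarrow>
     (\<forall>\<rho>\<in>D. regular_pair E (polytopic N \<alpha> Av \<rho>) \<and> causal_pair E (polytopic N \<alpha> Av \<rho>)) \<and>
     (\<exists>P. (\<forall>i\<in>{1..N}. pos_def (P i)) \<and>
        (\<forall>\<rho> \<eta>. descriptor_solution E (polytopic N \<alpha> Av) D \<rho> \<eta> \<longrightarrow>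
           (\<forall>t. \<eta> t \<noteq> 0 \<longrightarrow>
              descriptor_lyapunov E (polytopic N \<alpha> P) (\<rho> (Suc t)) (\<eta> (Suc t))
              - descriptor_lyapunov E (polytopic N \<alpha> P) (\<rho> t) (\<eta> t) < 0)))"


(* Stability of the origin for x(t+1) = F (x t); the solution from x0 is t |-> (F ^^ t) x0. *)
definition origin_stable :: "('a::real_normed_vector \<Rightarrow> 'a) \<Rightarrow> bool" where
  "origin_stable F \<longleftrightarrow>
     F 0 = 0 \<and> (\<forall>\<epsilon>>0. \<exists>\<delta>>0. \<forall>x0. norm x0 < \<delta> \<longrightarrow> (\<forall>t. norm ((F ^^ t) x0) < \<epsilon>))"

definition origin_locally_asymptotically_stable :: "('a::real_normed_vector \<Rightarrow> 'a) \<Rightarrow> bool" where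
  "origin_locally_asymptotically_stable F \<longleftrightarrow>
     origin_stable F \<and> (\<exists>\<delta>>0. \<forall>x0. norm x0 < \<delta> \<longrightarrow> (\<lambda>t. (F ^^ t) x0) \<longlonglongrightarrow> 0)"

definition origin_globally_asymptotically_stable :: "('a::real_normed_vector \<Rightarrow> 'a) \<Rightarrow> bool" where
  "origin_globally_asymptotically_stable F \<longleftrightarrow>
     origin_stable F \<and> (\<forall>x0. (\<lambda>t. (F ^^ t) x0) \<longlonglongrightarrow> 0)"

end

theory Submission
  imports Defs
begin

text \<open>By admissibility, \<open>W x = (x, 0)\<^sup>T P(x) (x, 0)\<close> decreases strictly along the closed loop
  inside \<open>X\<close>: since \<open>L x *v Z x = 0\<close>, the vector \<open>Z x\<close> starts a descriptor solution whose next value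
  has upper block \<open>F x\<close>, the successor of \<open>x\<close>, and which continues forever because \<open>L2\<close> is invertible.
  Moreover \<open>W\<close> is continuous and bounded below by a multiple of \<open>(norm x)\<^sup>2\<close> on \<open>X\<close>. Strict decrease
  alone, without a uniform rate, forces convergence to the origin: at a nonzero limit point of a
  bounded orbit the continuous function \<open>W\<close> could no longer decrease.\<close>

subsection \<open>Discrete-time Lyapunov functions\<close>

text \<open>\<open>W\<close> decreases along the orbit to some limit \<open>w\<close>, and a
  compactness argument shows that \<open>w\<close> is 0. The decrease is only assumed at points
  whose image is again in \<open>C\<close>, because the descriptor system yields it only when the
  next parameter \<open>F x\<close> is admissible too.\<close>

lemma lyapunov_orbit_tendsto_0:
  fixes F :: "'a::real_normed_vector \<Rightarrow> 'a" and W :: "'a \<Rightarrow> real"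
  assumes F: "continuous_on UNIV F" and F0: "F 0 = 0"
    and W: "continuous_on UNIV W" and W0: "W 0 = 0"
    and c: "0 < c" and lower: "\<And>x. x \<in> C \<Longrightarrow> c * (norm x)\<^sup>2 \<le> W x"
    and decrease: "\<And>x. x \<in> C \<Longrightarrow> F x \<in> C \<Longrightarrow> x \<noteq> 0 \<Longrightarrow> W (F x) < W x"
    and C: "compact C" and orbit: "\<And>t. (F ^^ t) x0 \<in> C"
  shows "(\<lambda>t. (F ^^ t) x0) \<longlonglongrightarrow> 0"
proof -
  define x where "x t = (F ^^ t) x0" for t
  have xC: "x t \<in> C" and xS: "x (Suc t) = F (x t)" for t
    using orbit by (auto simp: x_def)
  have dec: "W (x (Suc t)) \<le> W (x t)" for t
    using decrease[of "x t"] xC[of t] xC[of "Suc t"] F0 by (cases "x t = 0") (auto simp: xS)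
  have nonneg: "0 \<le> W (x t)" for t
    using lower[OF xC[of t]] c by (smt (verit) mult_nonneg_nonneg zero_le_power2)
  obtain w where w: "(\<lambda>t. W (x t)) \<longlonglongrightarrow> w"
    by (rule decseq_convergent[of "\<lambda>t. W (x t)" 0]) (use dec nonneg in \<open>simp_all add: decseq_Suc_iff\<close>)
  obtain l r where l: "l \<in> C" and r: "strict_mono (r :: nat \<Rightarrow> nat)" and lim: "(x \<circ> r) \<longlonglongrightarrow> l"
    using C xC unfolding compact_def by blast
  have lim_F: "(\<lambda>k. F (x (r k))) \<longlonglongrightarrow> F l"
    using continuous_on_tendsto_compose[OF F lim] by (simp add: o_def)
  \<comment> \<open>\<open>F l\<close> is the limit of the successors \<open>x (Suc (r k))\<close>,
    all in the closed set \<open>C\<close>; this makes the decrease available at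
    \<open>l\<close>.\<close>
  have Fl: "F l \<in> C"
    using closed_sequentially[OF compact_imp_closed[OF C] _ lim_F] xC by (metis xS)
  have "W l = w"
    using continuous_on_tendsto_compose[OF W lim] LIMSEQ_subseq_LIMSEQ[OF w r]
    by (auto simp: o_def intro: LIMSEQ_unique)
  moreover have "W (F l) = w"
    using continuous_on_tendsto_compose[OF W lim_F] LIMSEQ_subseq_LIMSEQ[OF LIMSEQ_Suc[OF w] r]
    by (auto simp: o_def xS intro: LIMSEQ_unique)
  \<comment> \<open>If \<open>l\<close> were nonzero, the decrease at \<open>l\<close> would give
    \<open>w < w\<close>. Hence \<open>l = 0\<close> and \<open>w = W 0 = 0\<close>.\<close>
  ultimately have "w = 0"
    using decrease[OF l Fl] W0 by force
  \<comment> \<open>The lower bound on \<open>W\<close> turns this into convergence of the entire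
    orbit, not merely of the subsequence.\<close>
  then have "(\<lambda>t. sqrt (W (x t) / c)) \<longlonglongrightarrow> 0"
    using tendsto_real_sqrt[OF tendsto_divide[OF w tendsto_const[of c]]] c by simp
  moreover have "norm (x t) \<le> sqrt (W (x t) / c)" for t
    using lower[OF xC[of t]] c by (intro real_le_rsqrt) (simp add: field_simps)
  ultimately have "x \<longlonglongrightarrow> 0"
    by (auto intro!: Lim_null_comparison[of x "\<lambda>t. sqrt (W (x t) / c)"])
  then show ?thesis
    by (simp add: x_def[abs_def])
qed

text \<open>The usual sublevel set argument, with one complication: both the decrease towards
  \<open>F x\<close> and the lower bound at \<open>F x\<close> require \<open>F x\<close> to lie in
  \<open>X\<close>, which has to be secured beforehand.\<close>

lemma lyapunov_stable_radius:
  fixes F :: "'a::real_normed_vector \<Rightarrow> 'a" and W :: "'a \<Rightarrow> real"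
  assumes F: "continuous_on UNIV F" and F0: "F 0 = 0"
    and W: "continuous_on UNIV W" and W0: "W 0 = 0"
    and c: "0 < c" and lower: "\<And>x. x \<in> X \<Longrightarrow> c * (norm x)\<^sup>2 \<le> W x"
    and decrease: "\<And>x. x \<in> X \<Longrightarrow> F x \<in> X \<Longrightarrow> x \<noteq> 0 \<Longrightarrow> W (F x) < W x"
    and X: "0 \<in> interior X" and e: "0 < \<epsilon>"
  shows "\<exists>\<delta>>0. \<forall>x0. norm x0 < \<delta> \<longrightarrow> (\<forall>t. norm ((F ^^ t) x0) < \<epsilon> \<and> (F ^^ t) x0 \<in> X)"
proof -
  obtain r where r: "0 < r" and rX: "ball 0 r \<subseteq> X"
    using X by (auto simp: mem_interior)
  have "isCont F 0" and "isCont W 0"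
    using F W by (auto simp: continuous_on_eq_continuous_at)
  \<comment> \<open>Continuity of \<open>F\<close> at 0 secures it: from the \<open>s\<close>-ball
    one step may leave a small ball, but not the \<open>r\<close>-ball inside
    \<open>X\<close>.\<close>
  then obtain s where s: "0 < s" and sF: "\<And>x. norm x < s \<Longrightarrow> norm (F x) < r"
    using r F0 by (force simp: continuous_at_eps_delta dist_norm)
  define e where "e = min \<epsilon> (min r s)"
  have e0: "0 < e" and e_le: "e \<le> \<epsilon>" "e \<le> r" "e \<le> s"
    using \<open>0 < \<epsilon>\<close> r s by (auto simp: e_def)
  have "0 < c * e\<^sup>2"
    using c e0 by simp
  then obtain d where d: "0 < d" and dW: "\<And>x. norm x < d \<Longrightarrow> W x < c * e\<^sup>2"
    using \<open>isCont W 0\<close> W0 by (force simp: continuous_at_eps_delta dist_norm)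
  \<comment> \<open>The bound on \<open>W\<close> is what propagates; the norm bound is recovered
    from it at each step through the lower bound \<open>c * (norm x)\<^sup>2\<close>.\<close>
  have orbit: "norm ((F ^^ t) x0) < e \<and> W ((F ^^ t) x0) < c * e\<^sup>2" if x0: "norm x0 < min d e" for x0 t
  proof (induction t)
    case 0
    then show ?case using x0 dW by simp
  next
    case (Suc t)
    let ?x = "(F ^^ t) x0"
    have x: "?x \<in> X" and Fx: "F ?x \<in> X"
      using Suc.IH e_le sF rX by (auto simp: subset_iff)
    have "W (F ?x) \<le> W ?x"
      using decrease[OF x Fx] F0 by (cases "?x = 0") auto
    then have Wlt: "W (F ?x) < c * e\<^sup>2"
      using Suc.IH by linarith
    then have "c * (norm (F ?x))\<^sup>2 < c * e\<^sup>2"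
      using lower[OF Fx] by linarith
    then have "norm (F ?x) < e"
      using c e0 by (simp add: power_less_imp_less_base)
    with Wlt show ?case by simp
  qed
  have "norm ((F ^^ t) x0) < \<epsilon> \<and> (F ^^ t) x0 \<in> X" if "norm x0 < min d e" for x0 t
    using orbit[OF that, of t] e_le rX by (auto simp: subset_iff)
  then show ?thesis
    using d e0 by (meson min_less_iff_conj)
qed

lemma lyapunov_locally_asymptotically_stable:
  fixes F :: "'a::{real_normed_vector, heine_borel} \<Rightarrow> 'a" and W :: "'a \<Rightarrow> real"
  assumes F: "continuous_on UNIV F" and F0: "F 0 = 0"
    and W: "continuous_on UNIV W" and W0: "W 0 = 0"
    and c: "0 < c" and lower: "\<And>x. x \<in> X \<Longrightarrow> c * (norm x)\<^sup>2 \<le> W x"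
    and decrease: "\<And>x. x \<in> X \<Longrightarrow> F x \<in> X \<Longrightarrow> x \<noteq> 0 \<Longrightarrow> W (F x) < W x"
    and X: "0 \<in> interior X"
  shows "origin_locally_asymptotically_stable F"
proof -
  have radius: "\<exists>\<delta>>0. \<forall>x0. norm x0 < \<delta> \<longrightarrow>
      (\<forall>t. norm ((F ^^ t) x0) < \<epsilon> \<and> (F ^^ t) x0 \<in> X)" if "0 < \<epsilon>" for \<epsilon>
    by (rule lyapunov_stable_radius[OF F F0 W W0 c lower decrease X that])
  have "\<exists>\<delta>>0. \<forall>x0. norm x0 < \<delta> \<longrightarrow> (\<forall>t. norm ((F ^^ t) x0) < \<epsilon>)" if "0 < \<epsilon>" for \<epsilon>
    using radius[OF that] by blast
  then have "origin_stable F"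
    by (simp add: origin_stable_def F0)
  moreover obtain r where r: "0 < r" and rX: "cball 0 r \<subseteq> X"
    using X by (auto simp: mem_interior_cball)
  obtain d where d: "0 < d" and dr: "\<And>x0 t. norm x0 < d \<Longrightarrow> norm ((F ^^ t) x0) < r"
    using radius[OF r] by blast
  \<comment> \<open>\<open>X\<close> need not be compact; a closed ball inside it serves as the
    compact set containing the orbit.\<close>
  have "(\<lambda>t. (F ^^ t) x0) \<longlonglongrightarrow> 0" if "norm x0 < d" for x0
    using lyapunov_orbit_tendsto_0[OF F F0 W W0 c, of "cball 0 r"] lower decrease rX dr[OF that]
    by (auto simp: subset_iff less_imp_le)
  ultimately show ?thesis
    using d unfolding origin_locally_asymptotically_stable_def by blast
qed

lemma lyapunov_globally_asymptotically_stable: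
  fixes F :: "'a::{real_normed_vector, heine_borel} \<Rightarrow> 'a" and W :: "'a \<Rightarrow> real"
  assumes F: "continuous_on UNIV F" and F0: "F 0 = 0"
    and W: "continuous_on UNIV W" and W0: "W 0 = 0"
    and c: "0 < c" and lower: "\<And>x. c * (norm x)\<^sup>2 \<le> W x"
    and decrease: "\<And>x. x \<noteq> 0 \<Longrightarrow> W (F x) < W x"
  shows "origin_globally_asymptotically_stable F"
proof -
  have "origin_stable F"
    using lyapunov_locally_asymptotically_stable[OF F F0 W W0 c, of UNIV] lower decrease
    by (simp add: origin_locally_asymptotically_stable_def)
  moreover have "(\<lambda>t. (F ^^ t) x0) \<longlonglongrightarrow> 0" for x0
  proof (rule lyapunov_orbit_tendsto_0[OF F F0 W W0 c lower decrease])
    \<comment> \<open>By the quadratic lower bound, this ball contains the sublevel set of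
      \<open>W\<close> at level \<open>W x0\<close>, which the orbit never leaves.\<close>
    show "compact (cball (0::'a) (sqrt (W x0 / c)))"
      by (rule compact_cball)
  next
    fix t
    have "W ((F ^^ t) x0) \<le> W x0"
    proof (induction t)
      case (Suc t)
      then show ?case
        using decrease[of "(F ^^ t) x0"] F0 by (cases "(F ^^ t) x0 = 0") auto
    qed simp
    then have "(norm ((F ^^ t) x0))\<^sup>2 \<le> W x0 / c"
      using lower[of "(F ^^ t) x0"] c by (simp add: field_simps)
    then show "(F ^^ t) x0 \<in> cball 0 (sqrt (W x0 / c))"
      by (simp add: real_le_rsqrt)
  qed
  ultimately show ?thesis
    by (simp add: origin_globally_asymptotically_stable_def)
qed

subsection \<open>Block matrices and polytopes of matrices\<close>

lemma sum_UNIV_Plus: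
  fixes g :: "'n::finite + 'p::finite \<Rightarrow> 'b::comm_monoid_add"
  shows "sum g UNIV = (\<Sum>k\<in>UNIV. g (Inl k)) + (\<Sum>k\<in>UNIV. g (Inr k))"
  by (simp only: UNIV_Plus_UNIV[symmetric]) (subst sum.Plus, simp_all)

lemma vcat_nth [simp]: "vcat a b $ Inl k = a $ k" "vcat a b $ Inr l = b $ l"
  by (simp_all add: vcat_def)

lemma vcat_eqI: "(\<And>k. u $ Inl k = w $ Inl k) \<Longrightarrow> (\<And>k. u $ Inr k = w $ Inr k) \<Longrightarrow> u = w"
  by (simp add: vec_eq_iff split_sum_all)

lemma vcat_eq_iff [simp]: "vcat a b = vcat a' b' \<longleftrightarrow> a = a' \<and> b = b'"
  by (auto simp: vec_eq_iff split_sum_all)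

lemma norm_vcat_0 [simp]: "norm (vcat a 0 :: real ^ ('n::finite + 'p::finite)) = norm a"
  by (simp add: norm_vec_def L2_set_def sum_UNIV_Plus)

lemma continuous_on_vcat_0:
  "continuous_on S (\<lambda>x::real ^ 'n::finite. vcat x 0 :: real ^ ('n + 'p::finite))"
proof -
  have "linear (\<lambda>x. vcat x 0 :: real ^ ('n + 'p))"
    by (intro linearI vcat_eqI) simp_all
  then show ?thesis
    by (simp add: linear_conv_bounded_linear linear_continuous_on)
qed

lemma vcat_matrix_mult:
  fixes M :: "real ^ 'k::finite ^ 'n::finite" and N :: "real ^ 'k ^ 'p::finite"
  shows "vcat M N ** Q = vcat (M ** Q) (N ** Q)"
  by (rule vcat_eqI) (simp_all add: matrix_matrix_mult_def vec_eq_iff)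

lemma vcat_matrix_vector_mult:
  fixes M :: "real ^ 'k::finite ^ 'n::finite" and N :: "real ^ 'k ^ 'p::finite"
  shows "vcat M N *v w = vcat (M *v w) (N *v w)"
  by (rule vcat_eqI) (simp_all add: matrix_vector_mult_def)

lemma hcat_matrix_vector_mult_vcat:
  fixes M :: "real ^ 'n::finite ^ 'm" and N :: "real ^ 'p::finite ^ 'm"
  shows "hcat M N *v vcat a b = M *v a + N *v b"
  by (simp add: matrix_vector_mult_def hcat_def vec_eq_iff sum_UNIV_Plus)

lemma matrix_vector_mult_uminus: "M *v (- b) = - (M *v b)" for M :: "real ^ 'k::finite ^ 'm"
  by (simp add: matrix_vector_mult_def vec_eq_iff sum_negf)

lemma matrix_add_rdistrib: "(M + N) ** Q = M ** Q + N ** Q" for M :: "real ^ 'k::finite ^ 'm"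
  by (simp add: matrix_matrix_mult_def vec_eq_iff distrib_right sum.distrib)

lemma data_matrix_recursion:
  fixes xd z :: "nat \<Rightarrow> _"
  assumes "\<And>j. xd (Suc (\<tau> j)) = A *v z (\<tau> j) + B *v ud (\<tau> j)"
  shows "data_matrix \<tau> (\<lambda>k. xd (Suc k)) = A ** data_matrix \<tau> z + B ** data_matrix \<tau> ud"
  by (simp add: data_matrix_def assms vec_eq_iff matrix_matrix_mult_def matrix_vector_mult_def)

lemma polytopic_vcat:
  "polytopic N \<alpha> (\<lambda>i. vcat (M i) (Q i)) \<rho> = vcat (polytopic N \<alpha> M \<rho>) (polytopic N \<alpha> Q \<rho>)"
  by (rule vcat_eqI) (simp_all add: polytopic_def)

lemma matrix_mult_polytopic:
  "Q ** polytopic N \<alpha> M \<rho> = polytopic N \<alpha> (\<lambda>i. Q ** M i) \<rho>"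
proof -
  have "(\<Sum>k\<in>UNIV. Q $ i $ k * (\<Sum>l = 1..N. \<alpha> l \<rho> * M l $ k $ j)) =
      (\<Sum>l = 1..N. \<alpha> l \<rho> * (\<Sum>k\<in>UNIV. Q $ i $ k * M l $ k $ j))" for i j
    unfolding sum_distrib_left by (subst sum.swap) (simp add: mult.left_commute)
  then show ?thesis
    by (simp add: polytopic_def matrix_matrix_mult_def vec_eq_iff)
qed

lemma polytopic_add:
  "polytopic N \<alpha> (\<lambda>i. M i + Q i) \<rho> = polytopic N \<alpha> M \<rho> + polytopic N \<alpha> Q \<rho>"
  by (simp add: polytopic_def scaleR_add_right sum.distrib)

lemma polytopic_cong:
  "(\<And>i. i \<in> {1..N} \<Longrightarrow> M i = Q i) \<Longrightarrow> polytopic N \<alpha> M \<rho> = polytopic N \<alpha> Q \<rho>"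
  unfolding polytopic_def by (rule sum.cong) simp_all

lemma polytopic_const: "(\<Sum>i = 1..N. \<alpha> i \<rho>) = 1 \<Longrightarrow> polytopic N \<alpha> (\<lambda>i. M) \<rho> = M"
  by (simp add: polytopic_def flip: scaleR_left.sum)

lemma polytopic_quadratic_form:
  "u \<bullet> (polytopic N \<alpha> P \<rho> *v u) = (\<Sum>i = 1..N. \<alpha> i \<rho> * (u \<bullet> (P i *v u)))"
proof -
  have "polytopic N \<alpha> P \<rho> *v u = (\<Sum>i = 1..N. \<alpha> i \<rho> *\<^sub>R (P i *v u))"
  proof -
    have "(\<Sum>k\<in>UNIV. (\<Sum>l = 1..N. \<alpha> l \<rho> * P l $ i $ k) * u $ k) =
        (\<Sum>l = 1..N. \<alpha> l \<rho> * (\<Sum>k\<in>UNIV. P l $ i $ k * u $ k))" for i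
      unfolding sum_distrib_left sum_distrib_right by (subst sum.swap) (simp add: mult.assoc)
    then show ?thesis
      by (simp add: polytopic_def matrix_vector_mult_def vec_eq_iff)
  qed
  then show ?thesis
    by (simp add: inner_sum_right)
qed

lemma continuous_on_polytopic:
  fixes M :: "nat \<Rightarrow> real ^ 'k::finite ^ 'm::finite"
  assumes "\<And>i. i \<in> {1..N} \<Longrightarrow> continuous_on S (\<alpha> i)"
  shows "continuous_on S (polytopic N \<alpha> M)"
  unfolding polytopic_def[abs_def] using assms by (intro continuous_intros) auto

lemma continuous_on_matrix_vector_mult:
  fixes M :: "'a::topological_space \<Rightarrow> real ^ 'k::finite ^ 'm::finite"
  assumes "continuous_on S M" "continuous_on S w"
  shows "continuous_on S (\<lambda>x. M x *v w x)"
  unfolding matrix_vector_mult_def using assms by (intro continuous_intros)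

text \<open>The constant is the minimum of the quadratic form on the compact unit sphere;
  homogeneity of degree 2 extends the bound to all vectors.\<close>

lemma pos_def_coercive:
  fixes P :: "real ^ 'n::finite ^ 'n"
  assumes "pos_def P"
  obtains c where "0 < c" "\<And>u. c * (norm u)\<^sup>2 \<le> u \<bullet> (P *v u)"
proof -
  have "continuous_on (sphere 0 1) (\<lambda>u. u \<bullet> (P *v u))"
    by (intro continuous_intros matrix_vector_mult_linear_continuous_on)
  from continuous_attains_inf[OF compact_sphere _ this]
  obtain w where w: "norm w = 1"
    and min: "\<And>u. norm u = 1 \<Longrightarrow> w \<bullet> (P *v w) \<le> u \<bullet> (P *v u)"
    by auto
  show thesis
  proof
    show "0 < w \<bullet> (P *v w)"
      using assms w unfolding pos_def_def by (metis norm_zero zero_neq_one)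
  next
    fix u
    show "w \<bullet> (P *v w) * (norm u)\<^sup>2 \<le> u \<bullet> (P *v u)"
    proof (cases "u = 0")
      case False
      define e where "e = u /\<^sub>R norm u"
      have u: "u = norm u *\<^sub>R e" and "norm e = 1"
        using False by (auto simp: e_def)
      have "u \<bullet> (P *v u) = (norm u)\<^sup>2 * (e \<bullet> (P *v e))"
        by (subst (1 2) u) (simp add: matrix_vector_mult_scaleR power2_eq_square)
      then show ?thesis
        using mult_left_mono[OF min[OF \<open>norm e = 1\<close>], of "(norm u)\<^sup>2"] by (simp add: mult.commute)
    qed simp
  qed
qed

text \<open>A convex combination of forms inherits the smallest of the vertex constants, so the
  bound is uniform in the parameter.\<close>

lemma polytopic_coercive:
  fixes P :: "nat \<Rightarrow> real ^ 'n::finite ^ 'n"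
  assumes P: "\<And>i. i \<in> {1..N} \<Longrightarrow> pos_def (P i)"
    and nonneg: "\<And>i \<rho>. i \<in> {1..N} \<Longrightarrow> \<rho> \<in> D \<Longrightarrow> 0 \<le> \<alpha> i \<rho>"
    and sum: "\<And>\<rho>. \<rho> \<in> D \<Longrightarrow> (\<Sum>i = 1..N. \<alpha> i \<rho>) = 1"
  obtains c where "0 < c" "\<And>\<rho> u. \<rho> \<in> D \<Longrightarrow> c * (norm u)\<^sup>2 \<le> u \<bullet> (polytopic N \<alpha> P \<rho> *v u)"
proof -
  have "\<forall>i\<in>{1..N}. \<exists>c>0. \<forall>u. c * (norm u)\<^sup>2 \<le> u \<bullet> (P i *v u)"
    using pos_def_coercive P by metis
  then obtain c where c: "\<And>i. i \<in> {1..N} \<Longrightarrow> 0 < c i"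
      "\<And>i u. i \<in> {1..N} \<Longrightarrow> c i * (norm u)\<^sup>2 \<le> u \<bullet> (P i *v u)"
    by metis
  \<comment> \<open>Inserting 1 keeps the set nonempty, hence \<open>Min\<close> meaningful, even
    for \<open>N = 0\<close>.\<close>
  define c0 where "c0 = Min (insert 1 (c ` {1..N}))"
  have "0 < c0"
    using c(1) by (simp add: c0_def)
  have c0: "c0 \<le> c i" if "i \<in> {1..N}" for i
    unfolding c0_def using that by (intro Min_le) auto
  show thesis
  proof
    fix \<rho> and u :: "real ^ 'n" assume \<rho>: "\<rho> \<in> D"
    have "c0 * (norm u)\<^sup>2 = (\<Sum>i = 1..N. \<alpha> i \<rho> * (c0 * (norm u)\<^sup>2))"
      using sum[OF \<rho>] by (simp flip: sum_distrib_right)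
    also have "\<dots> \<le> (\<Sum>i = 1..N. \<alpha> i \<rho> * (u \<bullet> (P i *v u)))"
      using c(2) c0 nonneg[OF _ \<rho>]
      by (intro sum_mono mult_left_mono order_trans[OF mult_right_mono[OF c0 zero_le_power2]]) auto
    finally show "c0 * (norm u)\<^sup>2 \<le> u \<bullet> (polytopic N \<alpha> P \<rho> *v u)"
      by (simp add: polytopic_quadratic_form)
  qed fact
qed

lemma invertible_matrix_inv:
  assumes "invertible M"
  shows "M ** matrix_inv M = mat 1" "matrix_inv M ** M = mat 1"
  using someI_ex[OF assms[unfolded invertible_def]] by (simp_all add: matrix_inv_def)

text \<open>Serves twice: to read off \<open>Zu x\<close> from \<open>L x *v Z x = 0\<close>, and to
  choose lower blocks that satisfy the algebraic constraint of the descriptor system.\<close>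

lemma matrix_inv_vector_solve:
  fixes M :: "real ^ 'p::finite ^ 'p"
  assumes "invertible M"
  shows "a + M *v b = 0 \<longleftrightarrow> b = - (matrix_inv M *v a)"
proof
  assume "a + M *v b = 0"
  then have "a = - (M *v b)"
    by (simp add: eq_neg_iff_add_eq_0)
  then show "b = - (matrix_inv M *v a)"
    using assms by (simp add: matrix_vector_mult_uminus matrix_vector_mul_assoc invertible_matrix_inv)
next
  assume "b = - (matrix_inv M *v a)"
  then show "a + M *v b = 0"
    using assms by (simp add: matrix_vector_mult_uminus matrix_vector_mul_assoc invertible_matrix_inv)
qed

subsection \<open>The descriptor system\<close>

abbreviation (input) descriptor_E :: "real ^ ('n::finite + 'p::finite) ^ ('n + 'p)" where
  "descriptor_E \<equiv> vcat (hcat (mat 1 :: real ^ 'n ^ 'n) 0) 0"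

lemma descriptor_E_mult_vcat: "descriptor_E *v vcat a b = vcat a 0"
  by (simp add: vcat_matrix_vector_mult hcat_matrix_vector_mult_vcat)

text \<open>The form is that of \<open>P \<rho>\<close> evaluated at \<open>E *v \<eta>\<close>, and
  the singular \<open>E\<close> erases the lower block. The Lyapunov function therefore sees only
  the state.\<close>

lemma descriptor_lyapunov_vcat:
  fixes a :: "real ^ 'n::finite" and b :: "real ^ 'p::finite"
  shows "descriptor_lyapunov descriptor_E P \<rho> (vcat a b) = vcat a 0 \<bullet> (P \<rho> *v vcat a 0)"
proof -
  have "descriptor_lyapunov E P \<rho> \<eta> = (E *v \<eta>) \<bullet> (P \<rho> *v (E *v \<eta>))"
    for E :: "real ^ ('n + 'p) ^ ('n + 'p)" and \<eta>
    by (simp add: descriptor_lyapunov_def transpose_matrix_vector inner_commute[of \<eta>]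
        dot_lmul_matrix inner_commute[of "P \<rho> *v (E *v \<eta>)"] flip: matrix_vector_mul_assoc)
  then show ?thesis
    by (simp add: descriptor_E_mult_vcat)
qed

text \<open>Admissibility speaks about infinite solutions, so a single step must be extended to all
  times. The lower rows demand \<open>Q (\<rho> t) *v \<eta> t = 0\<close> at every time; the upper
  block evolves freely by \<open>M\<close>, and invertibility of \<open>K\<close> then supplies a
  matching lower block.\<close>

lemma descriptor_solution_exists:
  fixes M :: "'q \<Rightarrow> real ^ ('n::finite + 'p::finite) ^ 'n"
  assumes \<rho>: "\<And>t. \<rho> t \<in> D"
    and Q: "\<And>r. r \<in> D \<Longrightarrow> Q r = hcat (J r) (K r)" "\<And>r. r \<in> D \<Longrightarrow> invertible (K r)"
    and \<zeta>: "Q (\<rho> 0) *v \<zeta> = 0"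
  obtains \<eta> b where "descriptor_solution descriptor_E (\<lambda>r. vcat (M r) (Q r)) D \<rho> \<eta>"
    "\<eta> 0 = \<zeta>" "\<eta> (Suc 0) = vcat (M (\<rho> 0) *v \<zeta>) b"
proof -
  \<comment> \<open>For \<open>r\<close> in \<open>D\<close>, this is the only vector with upper
    block \<open>a\<close> in the kernel of \<open>Q r\<close>.\<close>
  define lift where "lift r a = vcat a (- (matrix_inv (K r) *v (J r *v a)))" for r a
  have lift: "Q r *v lift r a = 0" if "r \<in> D" for r a
    using that matrix_inv_vector_solve[OF Q(2)[OF that], of "J r *v a"]
    by (simp add: lift_def Q(1) hcat_matrix_vector_mult_vcat)
  \<comment> \<open>The state is updated with the old parameter, but the lower block is solved with
    the new one, since the constraint on \<open>\<eta> (Suc t)\<close> involves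
    \<open>\<rho> (Suc t)\<close>.\<close>
  define \<eta> where "\<eta> = rec_nat \<zeta> (\<lambda>t e. lift (\<rho> (Suc t)) (M (\<rho> t) *v e))"
  have \<eta>_zero: "\<eta> 0 = \<zeta>" and \<eta>_Suc: "\<eta> (Suc t) = lift (\<rho> (Suc t)) (M (\<rho> t) *v \<eta> t)" for t
    by (simp_all add: \<eta>_def)
  have "Q (\<rho> t) *v \<eta> t = 0" for t
    using \<zeta> \<rho> by (cases t) (simp_all add: \<eta>_zero \<eta>_Suc lift)
  then have "descriptor_solution descriptor_E (\<lambda>r. vcat (M r) (Q r)) D \<rho> \<eta>"
    using \<rho> unfolding descriptor_solution_def
    by (simp add: vcat_matrix_vector_mult[of "M _"] \<eta>_Suc lift_def descriptor_E_mult_vcat)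
  then show thesis
    by (rule that) (simp_all add: \<eta>_zero \<eta>_Suc lift_def)
qed

section \<open>The data-driven closed loop and its stability\<close>

theorem theorem3:
  fixes f :: "real ^ 'n \<Rightarrow> real ^ 'n"
    and A :: "real ^ ('n::finite + 'p::finite) ^ 'n"
    and B :: "real ^ 'm ^ 'n"
    and Z :: "real ^ 'n \<Rightarrow> real ^ ('n + 'p)"
    and Zu :: "real ^ 'n \<Rightarrow> real ^ 'p"
    and ud :: "nat \<Rightarrow> real ^ 'm"
    and xd :: "nat \<Rightarrow> real ^ 'n"
    and \<tau> :: "'t::finite \<Rightarrow> nat"
    and U0 :: "real ^ 't ^ 'm"
    and Z0 :: "real ^ 't ^ ('n + 'p)"
    and X1 :: "real ^ 't ^ 'n"
    and X :: "(real ^ 'n) set"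
    and L :: "real ^ 'n \<Rightarrow> real ^ ('n + 'p) ^ 'p"
    and L1 :: "real ^ 'n \<Rightarrow> real ^ 'n ^ 'p"
    and L2 :: "real ^ 'n \<Rightarrow> real ^ 'p ^ 'p"
    and N :: nat
    and \<alpha> :: "nat \<Rightarrow> real ^ 'n \<Rightarrow> real"
    and v :: "nat \<Rightarrow> real ^ 'n"
    and K :: "nat \<Rightarrow> real ^ ('n + 'p) ^ 'm"
    and G :: "nat \<Rightarrow> real ^ ('n + 'p) ^ 't"
    and Gbar :: "real ^ 'n \<Rightarrow> real ^ 'n ^ 't"
    and Gund :: "real ^ 'n \<Rightarrow> real ^ 'p ^ 't"
  assumes f_cont: "continuous_on UNIV f" and f_zero: "f 0 = 0"
    and f_eq: "\<And>x. f x = A *v Z x"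
    and Z_cont: "continuous_on UNIV Z" and Z_zero: "Z 0 = 0"
    and Z_form: "\<And>x. Z x = vcat x (Zu x)"
    and times: "bij_betw \<tau> UNIV {..<CARD('t)}"
    and data: "\<And>k. k < CARD('t) \<Longrightarrow> xd (Suc k) = A *v Z (xd k) + B *v ud k"
    and U0: "U0 = data_matrix \<tau> ud"
    and Z0: "Z0 = data_matrix \<tau> (\<lambda>k. Z (xd k))"
    and X1: "X1 = data_matrix \<tau> (\<lambda>k. xd (Suc k))"
    and X_int: "0 \<in> interior X"
    and L_annih: "\<And>x. x \<in> X \<Longrightarrow> L x *v Z x = 0"
    and L_blocks: "\<And>x. x \<in> X \<Longrightarrow> L x = hcat (L1 x) (L2 x)"
    and L2_inv: "\<And>x. x \<in> X \<Longrightarrow> invertible (L2 x)"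
    and v_in: "\<And>i. i \<in> {1..N} \<Longrightarrow> v i \<in> X"
    and L_poly: "\<And>x. x \<in> X \<Longrightarrow> L x = polytopic N \<alpha> (\<lambda>i. L (v i)) x"
    and \<alpha>_cont: "\<And>i. i \<in> {1..N} \<Longrightarrow> continuous_on UNIV (\<alpha> i)"
    and \<alpha>_nonneg: "\<And>i x. i \<in> {1..N} \<Longrightarrow> x \<in> X \<Longrightarrow> 0 \<le> \<alpha> i x"
    and \<alpha>_sum: "\<And>x. x \<in> X \<Longrightarrow> (\<Sum>i = 1..N. \<alpha> i x) = 1"
    and KG: "\<And>i. i \<in> {1..N} \<Longrightarrow> vcat U0 Z0 ** G i = vcat (K i) (mat 1)"
    and G_blocks: "\<And>x. polytopic N \<alpha> G x = hcat (Gbar x) (Gund x)"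
    and admissible: "poly_quadratically_admissible
          (vcat (hcat (mat 1 :: real ^ 'n ^ 'n) 0) 0 :: real ^ ('n + 'p) ^ ('n + 'p))
          N \<alpha> (\<lambda>i. vcat (X1 ** G i) (L (v i))) X"
  shows "(\<forall>x\<in>X. f x + B *v (polytopic N \<alpha> K x *v Z x) = (X1 ** polytopic N \<alpha> G x) *v Z x)
    \<and> (\<forall>x\<in>X. (X1 ** polytopic N \<alpha> G x) *v Z x
         = (X1 ** Gbar x - X1 ** Gund x ** matrix_inv (L2 x) ** L1 x) *v x)
    \<and> origin_locally_asymptotically_stable (\<lambda>x. (X1 ** polytopic N \<alpha> G x) *v Z x)
    \<and> (X = UNIV \<longrightarrow>
        origin_globally_asymptotically_stable (\<lambda>x. (X1 ** polytopic N \<alpha> G x) *v Z x))"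
proof -
  let ?G = "polytopic N \<alpha> G"
  define F where "F x = (X1 ** ?G x) *v Z x" for x
  have "X1 = A ** Z0 + B ** U0"
    unfolding X1 Z0 U0
    by (rule data_matrix_recursion) (use data times in \<open>auto simp: bij_betw_def\<close>)
  moreover have "U0 ** G i = K i" "Z0 ** G i = mat 1" if "i \<in> {1..N}" for i
    using KG[OF that] by (simp_all add: vcat_matrix_mult)
  \<comment> \<open>The unknown \<open>A\<close> and \<open>B\<close> enter only through the data:
    multiplying the data equation by \<open>G i\<close> produces the closed-loop matrix with gain
    \<open>K i\<close>.\<close>
  ultimately have X1G: "X1 ** G i = A + B ** K i" if "i \<in> {1..N}" for i
    using that by (simp add: matrix_add_rdistrib flip: matrix_mul_assoc)
  \<comment> \<open>On \<open>X\<close> the weights sum to 1, so averaging over the vertices leaves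
    the constant term \<open>A\<close> unchanged.\<close>
  have "X1 ** ?G x = A + B ** polytopic N \<alpha> K x" if "x \<in> X" for x
  proof -
    have "X1 ** ?G x = polytopic N \<alpha> (\<lambda>i. A + B ** K i) x"
      unfolding matrix_mult_polytopic by (rule polytopic_cong) (rule X1G)
    then show ?thesis
      using \<alpha>_sum[OF that] by (simp only: polytopic_add polytopic_const matrix_mult_polytopic)
  qed
  then have closed_loop: "f x + B *v (polytopic N \<alpha> K x *v Z x) = F x" if "x \<in> X" for x
    using that by (simp add: F_def f_eq matrix_vector_mult_add_rdistrib matrix_vector_mul_assoc)

  have Zu: "Zu x = - (matrix_inv (L2 x) *v (L1 x *v x))" if "x \<in> X" for x
    using L_annih[OF that]
    by (simp add: L_blocks[OF that] Z_form hcat_matrix_vector_mult_vcat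
        matrix_inv_vector_solve[OF L2_inv[OF that]])
  have reduced: "F x = (X1 ** Gbar x - X1 ** Gund x ** matrix_inv (L2 x) ** L1 x) *v x"
    if "x \<in> X" for x
    by (simp add: F_def G_blocks Z_form Zu[OF that] hcat_matrix_vector_mult_vcat
        matrix_vector_mult_diff_rdistrib matrix_vector_mult_diff_distrib
        matrix_vector_mult_uminus matrix_vector_right_distrib
        flip: matrix_vector_mul_assoc)

  \<comment> \<open>Continuity is taken from the form with \<open>G\<close> and \<open>Z\<close>,
    valid on the whole space, rather than from the reduced form, which is available only on
    \<open>X\<close>.\<close>
  have F_cont: "continuous_on UNIV F"
    unfolding F_def matrix_vector_mul_assoc[symmetric]
    by (intro continuous_on_matrix_vector_mult continuous_on_const continuous_on_polytopic \<alpha>_cont Z_cont)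
  have F0: "F 0 = 0"
    by (simp add: F_def Z_zero)

  obtain P where P: "\<And>i. i \<in> {1..N} \<Longrightarrow> pos_def (P i)"
    and decrease: "\<And>\<rho> \<eta> t. descriptor_solution descriptor_E
        (polytopic N \<alpha> (\<lambda>i. vcat (X1 ** G i) (L (v i)))) X \<rho> \<eta> \<Longrightarrow> \<eta> t \<noteq> 0 \<Longrightarrow>
        descriptor_lyapunov descriptor_E (polytopic N \<alpha> P) (\<rho> (Suc t)) (\<eta> (Suc t))
          - descriptor_lyapunov descriptor_E (polytopic N \<alpha> P) (\<rho> t) (\<eta> t) < 0"
    using admissible unfolding poly_quadratically_admissible_def by blast
  \<comment> \<open>This is the descriptor Lyapunov function with the parameter set equal to the
    state; the lower block may be taken as 0 because \<open>E\<close> erases it.\<close>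
  define W where
    "W x = vcat x 0 \<bullet> (polytopic N \<alpha> P x *v (vcat x 0 :: real ^ ('n + 'p)))" for x
  have W_cont: "continuous_on UNIV W"
    unfolding W_def
    by (intro continuous_on_inner continuous_on_vcat_0 continuous_on_matrix_vector_mult
        continuous_on_polytopic \<alpha>_cont)
  have W0: "W 0 = 0"
  proof -
    have "(vcat 0 0 :: real ^ ('n + 'p)) = 0" by (rule vcat_eqI) simp_all
    then show ?thesis by (simp add: W_def)
  qed
  obtain c where c: "0 < c"
    and coercive: "\<And>x u. x \<in> X \<Longrightarrow> c * (norm u)\<^sup>2 \<le> u \<bullet> (polytopic N \<alpha> P x *v u)"
    by (rule polytopic_coercive[of N P X \<alpha>]) (use P \<alpha>_nonneg \<alpha>_sum in blast)+
  have W_lower: "c * (norm x)\<^sup>2 \<le> W x" if "x \<in> X" for x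
    using coercive[OF that, of "vcat x 0"] by (simp add: W_def)
  have W_decrease: "W (F x) < W x" if x: "x \<in> X" and Fx: "F x \<in> X" and "x \<noteq> 0" for x
  proof -
    \<comment> \<open>The decrease from time 0 to time 1 compares the parameters
      \<open>\<rho> 0 = x\<close> and \<open>\<rho> 1 = F x\<close>, which is exactly
      \<open>W x\<close> against \<open>W (F x)\<close>. Later values only have to stay in
      \<open>X\<close>, so \<open>F x\<close> is repeated.\<close>
    define \<rho> where "\<rho> t = (if t = 0 then x else F x)" for t :: nat
    have \<rho>X: "\<rho> t \<in> X" for t
      using x Fx by (simp add: \<rho>_def)
    have system: "polytopic N \<alpha> (\<lambda>i. vcat (X1 ** G i) (L (v i))) =
        (\<lambda>r. vcat (X1 ** ?G r) (polytopic N \<alpha> (\<lambda>i. L (v i)) r))"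
      by (simp add: fun_eq_iff polytopic_vcat matrix_mult_polytopic)
    have L_hcat: "polytopic N \<alpha> (\<lambda>i. L (v i)) r = hcat (L1 r) (L2 r)" if "r \<in> X" for r
      using L_poly[OF that] L_blocks[OF that] by simp
    have LZ: "polytopic N \<alpha> (\<lambda>i. L (v i)) (\<rho> 0) *v Z x = 0"
      using L_poly[OF x] L_annih[OF x] by (simp add: \<rho>_def)
    obtain \<eta> b where sol: "descriptor_solution descriptor_E
        (\<lambda>r. vcat (X1 ** ?G r) (polytopic N \<alpha> (\<lambda>i. L (v i)) r)) X \<rho> \<eta>"
      and \<eta>: "\<eta> 0 = Z x" "\<eta> (Suc 0) = vcat ((X1 ** ?G (\<rho> 0)) *v Z x) b"
      by (rule descriptor_solution_exists[where M = "\<lambda>r. X1 ** ?G r"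
            and \<rho> = \<rho> and D = X and Q = "polytopic N \<alpha> (\<lambda>i. L (v i))" and J = L1 and K = L2
            and \<zeta> = "Z x"]) (use \<rho>X L_hcat L2_inv LZ in blast)+
    have \<eta>_0: "\<eta> 0 = vcat x (Zu x)" and \<eta>_1: "\<eta> (Suc 0) = vcat (F x) b"
      using \<eta> by (simp_all add: Z_form \<rho>_def F_def)
    \<comment> \<open>The upper block of \<open>Z x\<close> is \<open>x\<close> itself, so a nonzero
      state gives a nonzero descriptor vector and the decrease is strict.\<close>
    have "\<eta> 0 \<noteq> 0"
      using \<open>x \<noteq> 0\<close> \<eta>_0 by (metis vcat_nth(1) vec_eq_iff zero_index)
    then show ?thesis
      using decrease[of \<rho> \<eta> 0] sol by (simp add: \<eta>_0 \<eta>_1 system descriptor_lyapunov_vcat W_def \<rho>_def)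
  qed

  have "origin_locally_asymptotically_stable F"
    by (rule lyapunov_locally_asymptotically_stable[OF F_cont F0 W_cont W0 c W_lower W_decrease X_int])
  moreover have "origin_globally_asymptotically_stable F" if "X = UNIV"
    by (rule lyapunov_globally_asymptotically_stable[OF F_cont F0 W_cont W0 c W_lower W_decrease])
      (simp_all add: that)
  ultimately show ?thesis
    using closed_loop reduced unfolding F_def[abs_def] by blast
qed

end
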